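(* Let $n$ and $k$ be integers with $4\leq k\leq \lfloor \frac{n-1}{2} \rfloor$. Then $$Ar(P_{n,k},C_6)=\begin{cases} \lfloor \frac{5n}{2} \rfloor, & \text{if } k\in \{\frac{n-1}{3}, \frac{n+1}{3}\};\\ \lfloor \frac{7n}{3} \rfloor, & \text{if } k=\frac{n-2}{2};\\ \frac{17n}{6}, & \text{if } k=\frac{n}{6};\\ 3n, & \text{otherwise.} \end{cases}$$
   Context: For integers $n\ge 3$ and $1\le k\le \lfloor \frac{n-1}{2}\rfloor$, the generalized Petersen graph $P_{n,k}$ is the simple graph with vertex set $\{u_i,v_i : 0\leq i\leq n-1\}$ ($2n$ distinct vertices) and edge set $\{u_iu_{i+1},\,u_iv_i,\,v_iv_{i+k} : 0\leq i\leq n-1\}$, subscripts taken modulo $n$; it has $3n$ edges. $C_d$ denotes the cycle on $d$ vertices. An edge-coloring of a graph $G$ is an arbitrary map from $E(G)$ to a set of colors (not necessarily proper); the number of colors of the coloring is the number of colors actually used. A copy of $H$ in $G$ is a (not necessarily induced) subgraph of $G$ isomorphic to $H$; it is rainbow if its edges receive pairwise distinct colors. The anti-Ramsey number $Ar(G,H)$ is the maximum number of colors in an edge-coloring of $G$ which has no rainbow copy of $H$; if $G$ contains no copy of $H$, then $Ar(G,H)=|E(G)|$. *)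

theory Defs
  imports Complex_Main
begin

record 'a graph =
  verts :: "'a set"
  edges :: "'a set set"

definition simple_graph :: "'a graph \<Rightarrow> bool" where
  "simple_graph G \<longleftrightarrow> (\<forall>e\<in>edges G. e \<subseteq> verts G \<and> card e = 2)"

definition subgraph :: "'a graph \<Rightarrow> 'a graph \<Rightarrow> bool" where
  "subgraph K G \<longleftrightarrow> simple_graph K \<and> verts K \<subseteq> verts G \<and> edges K \<subseteq> edges G"

definition isomorphic :: "'a graph \<Rightarrow> 'b graph \<Rightarrow> bool" where
  "isomorphic G H \<longleftrightarrow>
     (\<exists>f. bij_betw f (verts G) (verts H) \<and> edges H = (\<lambda>e. f ` e) ` edges G)"

definition copy_of :: "'b graph \<Rightarrow> 'a graph \<Rightarrow> 'a graph \<Rightarrow> bool" where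
  "copy_of H G K \<longleftrightarrow> subgraph K G \<and> isomorphic K H"

definition rainbow :: "('a set \<Rightarrow> 'c) \<Rightarrow> 'a graph \<Rightarrow> bool" where
  "rainbow c K \<longleftrightarrow> inj_on c (edges K)"

text \<open>Colours are natural numbers; on a finite graph only finitely many colours are used, so
  this is no restriction. For finite G the maximum is over a finite set, which is nonempty as soon
  as H has at least two edges (take a constant colouring). If G contains no copy of H, the value
  is the number of edges of G, as shown below.\<close>

definition anti_ramsey :: "'a graph \<Rightarrow> 'b graph \<Rightarrow> nat" where
  "anti_ramsey G H =
     Max {card (c ` edges G) | c :: 'a set \<Rightarrow> nat. \<not> (\<exists>K. copy_of H G K \<and> rainbow c K)}"

lemma anti_ramsey_no_copy:
  assumes "finite (edges G)" and "\<not> (\<exists>K. copy_of H G K)"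
  shows "anti_ramsey G H = card (edges G)"
proof -
  obtain c :: "'a set \<Rightarrow> nat" where "inj_on c (edges G)"
    using finite_imp_inj_to_nat_seg[OF assms(1)] by blast
  then have c: "card (c ` edges G) = card (edges G)"
    by (rule card_image)
  have le: "card (d ` edges G) \<le> card (edges G)" for d :: "'a set \<Rightarrow> nat"
    using assms(1) by (rule card_image_le)
  have "finite {card (d ` edges G) | d :: 'a set \<Rightarrow> nat. True}"
    by (rule finite_subset[of _ "{..card (edges G)}"]) (use le in auto)
  then show ?thesis
    unfolding anti_ramsey_def using assms(2) le c
    by (intro Max_eqI) (auto simp: eq_commute)
qed

definition cycle_graph :: "nat \<Rightarrow> nat graph" where
  "cycle_graph d = \<lparr> verts = {0..<d}, edges = {{i, (i + 1) mod d} | i. i < d} \<rparr>"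

datatype petersen_vertex = U nat | V nat

definition petersen :: "nat \<Rightarrow> nat \<Rightarrow> petersen_vertex graph" where
  "petersen n k = \<lparr>
     verts = {U i | i. i < n} \<union> {V i | i. i < n},
     edges = {{U i, U ((i + 1) mod n)} | i. i < n}
           \<union> {{U i, V i} | i. i < n}
           \<union> {{V i, V ((i + k) mod n)} | i. i < n} \<rparr>"

end

theory Submission
  imports Defs
begin

text \<open>A 6-cycle of \<open>P(n, k)\<close> uses an even number of spokes, and four or more spokes do not fit into six
  edges. Without spokes it is a closed walk of length 6 on one rim, which happens only for the inner
  rim when \<open>n = 6k\<close>. With two spokes it consists of \<open>p\<close> outer and \<open>q\<close> inner steps, where
  \<open>p + q = 4\<close> and \<open>p\<close> is congruent to \<open>qk\<close> or \<open>-qk\<close> modulo \<open>n\<close>. For \<open>k \<ge> 4\<close> and \<open>2k < n\<close> this is possible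
  only for \<open>(p, q) = (1, 3)\<close> with \<open>3k = n \<plusminus> 1\<close> and for \<open>(p, q) = (2, 2)\<close> with \<open>2k = n - 2\<close>
  (lemma \<open>hexagon_cases\<close>). In each case the 6-cycles are the translates of a single one: \<open>n\<close> of them
  with two spokes, \<open>k\<close> of them without. In all other cases there are none, and every edge may have
  its own colour.

  For a colouring of a graph \<open>G\<close> call \<open>|E(G)|\<close> minus the number of colours its loss; a class of \<open>m\<close>
  edges contributes \<open>m - 1\<close> to the loss. No 6-cycle is rainbow iff each one contains two edges of one
  class.

  Lower bound on the loss: if every edge lies on at most \<open>r\<close> of the 6-cycles, then a class of \<open>m\<close>
  edges can spoil at most \<open>rm/2\<close> of them, because each spoilt cycle uses two incidences. This suffices
  for \<open>m \<ge> 3\<close>; classes of size 2 are controlled by the number of 6-cycles through two given edges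
  (lemma \<open>repeated_color_loss\<close>). The resulting ratios of spoilt cycles to loss are at most 2 for
  \<open>3k = n \<plusminus> 1\<close>, at most 3/2 for \<open>2k = n - 2\<close> and at most 1 for \<open>n = 6k\<close>, so the losses are at
  least \<open>n/2\<close>, \<open>2n/3\<close> and \<open>k\<close>, rounded up.

  Upper bound on the loss: identifying the colours of one pair of edges costs at most one colour
  (lemma \<open>merging_coloring\<close>), so it is enough to list few pairs whose identification
  spoils every 6-cycle. For \<open>3k = n \<plusminus> 1\<close> these are every second pair of consecutive edges along the
  inner rim, since such a pair lies on two 6-cycles; for \<open>2k = n - 2\<close> two pairs of edges
  for each three consecutive 6-cycles, and one pair for each of the at most two remaining ones;
  for \<open>n = 6k\<close> one pair on each 6-cycle. The numbers of pairs agree with the lower bounds.\<close>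

section \<open>Hexagons and copies of the 6-cycle\<close>

definition hexagon :: "'a \<Rightarrow> 'a \<Rightarrow> 'a \<Rightarrow> 'a \<Rightarrow> 'a \<Rightarrow> 'a \<Rightarrow> 'a set set" where
  "hexagon a b c d e f = {{a, b}, {b, c}, {c, d}, {d, e}, {e, f}, {f, a}}"

lemma hexagon_rotate: "hexagon a b c d e f = hexagon b c d e f a"
  unfolding hexagon_def by auto

lemma hexagon_flip: "hexagon a b c d e f = hexagon f e d c b a"
proof -
  have "{f, e} = {e, f}" "{e, d} = {d, e}" "{d, c} = {c, d}" "{c, b} = {b, c}" "{b, a} = {a, b}"
    "{a, f} = {f, a}" by (rule insert_commute)+
  then show ?thesis unfolding hexagon_def by auto
qed

lemma hexagon_flip_3: "hexagon a b c d e f = hexagon c b a f e d"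
  by (subst hexagon_flip, subst hexagon_rotate, subst hexagon_rotate, subst hexagon_rotate) (rule refl)

lemma hexagon_rotate_2: "hexagon a b c d e f = hexagon c d e f a b"
  by (subst hexagon_rotate, subst hexagon_rotate) (rule refl)

lemma less_6_nat: "{i::nat. i < 6} = {0, 1, 2, 3, 4, 5}"
  by (simp add: set_eq_iff) linarith

lemma edges_cycle_graph_6: "edges (cycle_graph 6) = hexagon 0 1 2 3 4 5"
proof -
  have "edges (cycle_graph 6) = (\<lambda>i. {i, (i + 1) mod 6}) ` {i. i < 6}"
    unfolding cycle_graph_def setcompr_eq_image by simp
  also have "\<dots> = hexagon 0 1 2 3 4 5"
  proof -
    have "(0 + 1) mod 6 = (1::nat)" "(1 + 1) mod 6 = (2::nat)" "(2 + 1) mod 6 = (3::nat)"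
      "(3 + 1) mod 6 = (4::nat)" "(4 + 1) mod 6 = (5::nat)" "(5 + 1) mod 6 = (0::nat)"
      by simp_all
    then show ?thesis unfolding less_6_nat hexagon_def by (simp only: image_insert image_empty)
  qed
  finally show ?thesis .
qed

lemma verts_cycle_graph_6: "verts (cycle_graph 6) = {0, 1, 2, 3, 4, 5}"
  unfolding cycle_graph_def less_6_nat[symmetric] by auto

lemma image_hexagon:
  "(\<lambda>e. g ` e) ` hexagon a b c d e f = hexagon (g a) (g b) (g c) (g d) (g e) (g f)"
  unfolding hexagon_def by simp

lemma copy_of_cycle_6_hexagon:
  assumes "copy_of (cycle_graph 6) G K"
  obtains a b c d e f where "distinct [a, b, c, d, e, f]" "edges K = hexagon a b c d e f"
    "edges K \<subseteq> edges G"
proof -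
  have sub: "edges K \<subseteq> edges G" and simple: "simple_graph K"
    using assms by (auto simp: copy_of_def subgraph_def)
  obtain g where g: "bij_betw g (verts K) {0, 1, 2, 3, 4, 5::nat}"
    and img: "hexagon 0 1 2 3 4 5 = (\<lambda>e. g ` e) ` edges K"
    using assms unfolding copy_of_def isomorphic_def
      edges_cycle_graph_6 verts_cycle_graph_6 by blast
  define w where "w = inv_into (verts K) g"
  have w: "bij_betw w {0, 1, 2, 3, 4, 5} (verts K)"
    unfolding w_def by (rule bij_betw_inv_into[OF g])
  have "w ` g ` e = e" if "e \<in> edges K" for e
  proof -
    have "e \<subseteq> verts K" using simple that by (auto simp: simple_graph_def)
    then show ?thesis
      unfolding w_def using bij_betw_imp_inj_on[OF g] by (simp add: inv_into_image_cancel)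
  qed
  then have "edges K = (\<lambda>e. w ` e) ` (\<lambda>e. g ` e) ` edges K"
    by (simp add: image_image)
  then have "edges K = hexagon (w 0) (w 1) (w 2) (w 3) (w 4) (w 5)"
    by (simp flip: img add: image_hexagon)
  moreover have "distinct [w 0, w 1, w 2, w 3, w 4, w 5]"
    using bij_betw_imp_inj_on[OF w] by (simp add: inj_on_def)
  ultimately show ?thesis using that sub by blast
qed

text \<open>Together with the preceding lemma, this replaces copies of \<open>C\<^sub>6\<close> by hexagons: whether a copy
  is rainbow depends on its edge set only.\<close>

lemma hexagon_copy_of_cycle_6:
  assumes "simple_graph G" and dist: "distinct [a, b, c, d, e, f]"
    and sub: "hexagon a b c d e f \<subseteq> edges G"
  shows "\<exists>K. copy_of (cycle_graph 6) G K \<and> edges K = hexagon a b c d e f"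
proof -
  define K where "K = \<lparr>verts = {a, b, c, d, e, f}, edges = hexagon a b c d e f\<rparr>"
  define g :: "'a \<Rightarrow> nat" where "g x = (if x = a then 0 else if x = b then 1 else
    if x = c then 2 else if x = d then 3 else if x = e then 4 else 5)" for x
  have g: "g a = 0" "g b = 1" "g c = 2" "g d = 3" "g e = 4" "g f = 5"
    using dist by (auto simp: g_def)
  have K: "verts K = {a, b, c, d, e, f}" "edges K = hexagon a b c d e f"
    by (simp_all add: K_def)
  have dist_rev: "f \<noteq> a" using dist by auto
  have "simple_graph K"
    using dist dist_rev unfolding simple_graph_def K hexagon_def by simp
  moreover have "verts K \<subseteq> verts G"
  proof -
    have "verts K \<subseteq> \<Union> (hexagon a b c d e f)" unfolding K hexagon_def by simp
    also have "\<dots> \<subseteq> verts G"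
      using assms(1) sub unfolding simple_graph_def by blast
    finally show ?thesis .
  qed
  moreover have "edges K \<subseteq> edges G" using sub K by simp
  ultimately have "subgraph K G" by (simp add: subgraph_def)
  have "bij_betw g (verts K) (verts (cycle_graph 6))"
    unfolding verts_cycle_graph_6 K bij_betw_def by (simp add: g inj_on_def)
  moreover have "edges (cycle_graph 6) = (\<lambda>e. g ` e) ` edges K"
    unfolding edges_cycle_graph_6 K image_hexagon g ..
  ultimately have "isomorphic K (cycle_graph 6)"
    unfolding isomorphic_def by (intro exI[of _ g] conjI)
  with \<open>subgraph K G\<close> have "copy_of (cycle_graph 6) G K" by (simp add: copy_of_def)
  with K show ?thesis by blast
qed

section \<open>Colourings with few repeated colours\<close>

text \<open>Start with an injective colouring and process the pairs one at a time; recolouring the class of one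
  edge by the colour of the other loses at most one colour and keeps the equalities already achieved.
  The pairs need not be disjoint: chains of pairs produce larger colour classes.\<close>

lemma merging_coloring:
  assumes "finite E" and "finite M"
  shows "\<exists>c :: 'a \<Rightarrow> nat. card E \<le> card (c ` E) + card M \<and> (\<forall>(e, f)\<in>M. c e = c f)"
  using assms(2)
proof (induction M rule: finite_induct)
  case empty
  obtain c :: "'a \<Rightarrow> nat" where "inj_on c E"
    using finite_imp_inj_to_nat_seg[OF assms(1)] by blast
  then show ?case by (auto simp: card_image intro: exI[of _ c])
next
  case (insert p M)
  obtain c :: "'a \<Rightarrow> nat" where c: "card E \<le> card (c ` E) + card M" "\<forall>(e, f)\<in>M. c e = c f"
    using insert.IH by blast
  obtain e f where p: "p = (e, f)" by (cases p)
  define d where "d x = (if c x = c f then c e else c x)" for x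
  have "c ` E \<subseteq> insert (c f) (d ` E)" by (auto simp: d_def)
  then have "card (c ` E) \<le> card (insert (c f) (d ` E))"
    using assms(1) by (intro card_mono) auto
  also have "\<dots> \<le> Suc (card (d ` E))" by (rule card_insert_le_m1) auto
  finally have "card E \<le> card (d ` E) + card (insert p M)"
    using c(1) insert.hyps by simp
  moreover have "\<forall>(x, y)\<in>insert p M. d x = d y"
    using c(2) by (auto simp: d_def p)
  ultimately show ?case by blast
qed

text \<open>If \<open>D\<close> is a colour class, these are the indices of the sets \<open>C z\<close> in which \<open>D\<close> repeats its
  colour.\<close>

definition covered :: "'i set \<Rightarrow> ('i \<Rightarrow> 'a set) \<Rightarrow> 'a set \<Rightarrow> 'i set" where
  "covered I C D = {z \<in> I. \<exists>e\<in>C z \<inter> D. \<exists>f\<in>C z \<inter> D. e \<noteq> f}"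

text \<open>Each covered set contains two elements of \<open>D\<close>; count the incidences between \<open>D\<close> and the
  sets \<open>C z\<close> in both ways.\<close>

lemma card_covered_le_incidences:
  assumes "finite I" "finite D" and r: "\<And>e. e \<in> D \<Longrightarrow> card {z \<in> I. e \<in> C z} \<le> r"
  shows "2 * card (covered I C D) \<le> r * card D"
proof -
  have fin: "finite (covered I C D)" using assms(1) by (simp add: covered_def)
  have "2 \<le> card {e \<in> D. e \<in> C z}" if "z \<in> covered I C D" for z
  proof -
    obtain e f where "{e, f} \<subseteq> C z \<inter> D" "e \<noteq> f"
      using \<open>z \<in> covered I C D\<close> unfolding covered_def by blast
    then have "card {e, f} \<le> card {e \<in> D. e \<in> C z}"
      using assms(2) by (intro card_mono) auto
    with \<open>e \<noteq> f\<close> show ?thesis by simp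
  qed
  then have "(\<Sum>z\<in>covered I C D. 2) \<le> (\<Sum>z\<in>covered I C D. card {e \<in> D. e \<in> C z})"
    by (intro sum_mono)
  also have "\<dots> \<le> (\<Sum>z\<in>I. card {e \<in> D. e \<in> C z})"
    using assms(1) by (intro sum_mono2) (auto simp: covered_def)
  also have "\<dots> = (\<Sum>e\<in>D. card {z \<in> I. e \<in> C z})"
    by (rule sum_multicount_gen) (use assms in auto)
  also have "\<dots> \<le> (\<Sum>e\<in>D. r)" by (intro sum_mono r)
  finally show ?thesis by (simp add: mult.commute)
qed

lemma sum_fiber_excess:
  assumes "finite E"
  shows "(\<Sum>y\<in>c ` E. card {e \<in> E. c e = y} - 1) = card E - card (c ` E)"
proof -
  have pos: "1 \<le> card {e \<in> E. c e = y}" if "y \<in> c ` E" for y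
    using that assms by (auto simp: Suc_le_eq card_gt_0_iff)
  have "card E = (\<Sum>y\<in>c ` E. card {e \<in> E. c e = y})"
    using sum.image_gen[OF assms, of "\<lambda>_. 1::nat" c] by simp
  also have "\<dots> = (\<Sum>y\<in>c ` E. (card {e \<in> E. c e = y} - 1) + 1)"
    using pos by (intro sum.cong refl le_add_diff_inverse2[symmetric])
  also have "\<dots> = (\<Sum>y\<in>c ` E. card {e \<in> E. c e = y} - 1) + card (c ` E)"
    by (simp only: sum.distrib) simp
  finally show ?thesis by simp
qed

text \<open>Every set \<open>C z\<close> is covered by some colour class, so it is enough to bound the number of sets covered by
  a single class by \<open>p/q\<close> times its excess \<open>m - 1\<close> and to sum over the classes. For \<open>m \<ge> 3\<close> the bound
  \<open>rm/2\<close> from the incidences is good enough; for \<open>m = 2\<close> it would give \<open>r\<close>, which is too weak in the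
  applications with \<open>r > 1\<close>, and the number \<open>s\<close> of sets containing a given pair is used instead.\<close>

lemma repeated_color_loss:
  fixes p q r s :: nat
  assumes fin: "finite E" "finite I"
    and C: "\<And>z. z \<in> I \<Longrightarrow> C z \<subseteq> E" "\<And>z. z \<in> I \<Longrightarrow> \<not> inj_on c (C z)"
    and edge: "\<And>e. e \<in> E \<Longrightarrow> card {z \<in> I. e \<in> C z} \<le> r"
    and pair: "\<And>e f. e \<in> E \<Longrightarrow> f \<in> E \<Longrightarrow> e \<noteq> f \<Longrightarrow> card {z \<in> I. e \<in> C z \<and> f \<in> C z} \<le> s"
    and two: "q * s \<le> p" and many: "\<And>m. 3 \<le> m \<Longrightarrow> q * (r * m div 2) \<le> p * (m - 1)"
  shows "q * card I \<le> p * (card E - card (c ` E))"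
proof -
  define D where "D y = {e \<in> E. c e = y}" for y
  have class_bound: "q * card (covered I C (D y)) \<le> p * (card (D y) - 1)" for y
  proof -
    have D: "D y \<subseteq> E" "finite (D y)" using fin by (auto simp: D_def)
    consider "card (D y) \<le> 1" | "card (D y) = 2" | "3 \<le> card (D y)" by linarith
    then show ?thesis
    proof cases
      case 1
      then have "covered I C (D y) = {}"
        using card_le_Suc0_iff_eq[OF D(2)] by (auto simp: covered_def)
      then show ?thesis by simp
    next
      case 2
      then obtain e f where ef: "D y = {e, f}" "e \<noteq> f" by (auto simp: card_2_iff)
      have "card (covered I C (D y)) \<le> card {z \<in> I. e \<in> C z \<and> f \<in> C z}"
        using fin(2) by (intro card_mono) (auto simp: covered_def ef)
      also have "\<dots> \<le> s" using pair D ef by auto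
      finally have "q * card (covered I C (D y)) \<le> q * s" by simp
      also note two
      finally show ?thesis using 2 by simp
    next
      case 3
      have "2 * card (covered I C (D y)) \<le> r * card (D y)"
        using fin D edge by (intro card_covered_le_incidences) auto
      then have "q * card (covered I C (D y)) \<le> q * (r * card (D y) div 2)"
        by (intro mult_le_mono2) linarith
      also have "\<dots> \<le> p * (card (D y) - 1)" by (rule many[OF 3])
      finally show ?thesis .
    qed
  qed
  have "I \<subseteq> (\<Union>y\<in>c ` E. covered I C (D y))"
  proof
    fix z assume z: "z \<in> I"
    then obtain e f where "e \<in> C z" "f \<in> C z" "e \<noteq> f" "c e = c f"
      using C(2)[OF z] unfolding inj_on_def by blast
    moreover have "e \<in> E" "f \<in> E" using C(1)[OF z] calculation by auto
    ultimately have "z \<in> covered I C (D (c e))"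
      using z by (auto simp: covered_def D_def)
    with \<open>e \<in> E\<close> show "z \<in> (\<Union>y\<in>c ` E. covered I C (D y))" by blast
  qed
  then have "card I \<le> card (\<Union>y\<in>c ` E. covered I C (D y))"
    using fin by (intro card_mono) (auto simp: covered_def)
  also have "\<dots> \<le> (\<Sum>y\<in>c ` E. card (covered I C (D y)))"
    using fin by (intro card_UN_le) auto
  finally have "q * card I \<le> (\<Sum>y\<in>c ` E. q * card (covered I C (D y)))"
    by (simp flip: sum_distrib_left)
  also have "\<dots> \<le> (\<Sum>y\<in>c ` E. p * (card (D y) - 1))"
    by (intro sum_mono class_bound)
  also have "\<dots> = p * (card E - card (c ` E))"
    using sum_fiber_excess[OF fin(1), of c] by (simp add: D_def flip: sum_distrib_left)
  finally show ?thesis .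
qed

text \<open>The pairs in \<open>M\<close> yield a colouring that loses at most \<open>L\<close> colours, and \<open>L\<close> is also a lower bound for
  the loss; \<open>C ` I\<close> enumerates the edge sets of the copies of \<open>H\<close>.\<close>

lemma anti_ramsey_eq_card_minus_loss:
  assumes fin: "finite (edges G)" "finite M" and M: "card M \<le> L"
    and copies: "edges ` {K. copy_of H G K} = C ` I"
    and repeat: "\<And>c :: 'a set \<Rightarrow> nat. \<And>z. z \<in> I \<Longrightarrow> \<forall>(e, f)\<in>M. c e = c f \<Longrightarrow> \<not> inj_on c (C z)"
    and loss: "\<And>c :: 'a set \<Rightarrow> nat. (\<And>z. z \<in> I \<Longrightarrow> \<not> inj_on c (C z)) \<Longrightarrow>
      L \<le> card (edges G) - card (c ` edges G)"
  shows "anti_ramsey G H = card (edges G) - L"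
proof -
  have rb: "(\<exists>K. copy_of H G K \<and> rainbow c K) \<longleftrightarrow> (\<exists>z\<in>I. inj_on c (C z))" for c :: "'a set \<Rightarrow> nat"
  proof -
    have "(\<exists>K. copy_of H G K \<and> rainbow c K) \<longleftrightarrow> (\<exists>F \<in> edges ` {K. copy_of H G K}. inj_on c F)"
      by (auto simp: rainbow_def)
    also have "\<dots> \<longleftrightarrow> (\<exists>z\<in>I. inj_on c (C z))" unfolding copies by auto
    finally show ?thesis .
  qed
  have le: "card (c ` edges G) \<le> card (edges G)" for c :: "'a set \<Rightarrow> nat"
    using fin(1) by (rule card_image_le)
  have upper: "card (c ` edges G) \<le> card (edges G) - L"
    if "\<not> (\<exists>z\<in>I. inj_on c (C z))" for c :: "'a set \<Rightarrow> nat"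
    using loss[of c] that le[of c] by fastforce
  obtain c :: "'a set \<Rightarrow> nat" where
    c: "card (edges G) \<le> card (c ` edges G) + card M" "\<forall>(e, f)\<in>M. c e = c f"
    using merging_coloring[OF fin] by blast
  have good: "\<not> (\<exists>z\<in>I. inj_on c (C z))" using repeat[OF _ c(2)] by blast
  have card: "card (c ` edges G) = card (edges G) - L"
    using upper[OF good] c(1) M by linarith
  show ?thesis
    unfolding anti_ramsey_def rb
  proof (rule Max_eqI)
    show "finite {card (c ` edges G) | c :: 'a set \<Rightarrow> nat. \<not> (\<exists>z\<in>I. inj_on c (C z))}"
      by (rule finite_subset[of _ "{..card (edges G)}"]) (use le in auto)
  qed (use upper card good in \<open>auto intro!: exI[of _ c]\<close>)
qed

section \<open>Generalized Petersen graphs with integer indices\<close>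

lemma dvd_abs_less_imp_0:
  fixes m t :: int
  assumes "m dvd t" "\<bar>t\<bar> < m"
  shows "t = 0"
  using dvd_imp_le_int[of t m] assms by fastforce

lemma dvd_abs_less_double:
  fixes m t :: int
  assumes "m dvd t" "\<bar>t\<bar> < 2 * m"
  shows "t \<in> {- m, 0, m}"
proof -
  obtain q where t: "t = m * q" using assms(1) by (elim dvdE)
  have "0 < m" using assms(2) by linarith
  moreover have "m * \<bar>q\<bar> < m * 2" using assms(2) t \<open>0 < m\<close> by (simp add: abs_mult)
  ultimately have "\<bar>q\<bar> < 2" by simp
  then have "q \<in> {-1, 0, 1}" by auto
  with t show ?thesis by auto
qed

locale petersen_params =
  fixes n k :: nat
  assumes k_ge_4: "4 \<le> k" and k_less: "2 * k < n"
begin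

text \<open>Vertices are indexed by all integers, read modulo \<open>n\<close>. Translations then need no truncated
  subtraction and no case distinction for wrapping around, and equality of vertices or of edges of
  the same kind becomes divisibility of the difference of their indices by \<open>n\<close>.\<close>

definition u :: "int \<Rightarrow> petersen_vertex" where "u z = U (nat (z mod int n))"
definition v :: "int \<Rightarrow> petersen_vertex" where "v z = V (nat (z mod int n))"
definition outer :: "int \<Rightarrow> petersen_vertex set" where "outer z = {u z, u (z + 1)}"
definition spoke :: "int \<Rightarrow> petersen_vertex set" where "spoke z = {u z, v z}"
definition inner :: "int \<Rightarrow> petersen_vertex set" where "inner z = {v z, v (z + int k)}"

lemma n_pos: "0 < int n" using k_less by linarith

lemma u_eq_iff: "u x = u y \<longleftrightarrow> int n dvd x - y"
  using n_pos by (simp add: u_def eq_nat_nat_iff mod_eq_dvd_iff)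

lemma v_eq_iff: "v x = v y \<longleftrightarrow> int n dvd x - y"
  using n_pos by (simp add: v_def eq_nat_nat_iff mod_eq_dvd_iff)

lemma u_neq_v: "u x \<noteq> v y" "v y \<noteq> u x"
  by (simp_all add: u_def v_def)

lemma u_nat: "i < n \<Longrightarrow> U i = u (int i)" and v_nat: "i < n \<Longrightarrow> V i = v (int i)"
  by (simp_all add: u_def v_def)

lemma mod_nat: "U (m mod n) = u (int m)" "V (m mod n) = v (int m)"
  by (simp_all add: u_def v_def nat_mod_as_int)

lemma nat_residue:
  obtains i where "i < n" "u z = u (int i)" "v z = v (int i)"
proof
  show "nat (z mod int n) < n" using n_pos by (simp add: nat_less_iff)
  show "u z = u (int (nat (z mod int n)))" "v z = v (int (nat (z mod int n)))"
    using n_pos by (simp_all add: u_def v_def)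
qed

lemma cong_add:
  "u x = u y \<Longrightarrow> u (x + c) = u (y + c)" "v x = v y \<Longrightarrow> v (x + c) = v (y + c)"
  by (simp_all add: u_eq_iff v_eq_iff)

lemma u_cong_v: "u x = u y \<longleftrightarrow> v x = v y"
  by (simp add: u_eq_iff v_eq_iff)

lemma edges_petersen: "edges (petersen n k) = range outer \<union> range spoke \<union> range inner"
proof -
  have "{{U i, U ((i + 1) mod n)} | i. i < n} = range outer"
  proof (intro subset_antisym subsetI)
    fix e assume "e \<in> {{U i, U ((i + 1) mod n)} | i. i < n}"
    then obtain i where "i < n" "e = {U i, U ((i + 1) mod n)}" by blast
    then have "e = outer (int i)" by (simp only: outer_def u_nat mod_nat of_nat_add of_nat_1)
    then show "e \<in> range outer" by blast
  next
    fix e assume "e \<in> range outer"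
    then obtain z where "e = outer z" by blast
    moreover obtain i where "i < n" "u z = u (int i)" by (rule nat_residue)
    ultimately have "e = {U i, U ((i + 1) mod n)}"
      using cong_add(1)[of z "int i" 1] by (simp only: outer_def u_nat mod_nat of_nat_add of_nat_1)
    with \<open>i < n\<close> show "e \<in> {{U i, U ((i + 1) mod n)} | i. i < n}" by blast
  qed
  moreover have "{{U i, V i} | i. i < n} = range spoke"
  proof (intro subset_antisym subsetI)
    fix e assume "e \<in> {{U i, V i} | i. i < n}"
    then obtain i where "i < n" "e = {U i, V i}" by blast
    then have "e = spoke (int i)" by (simp only: spoke_def u_nat v_nat)
    then show "e \<in> range spoke" by blast
  next
    fix e assume "e \<in> range spoke"
    then obtain z where "e = spoke z" by blast
    moreover obtain i where "i < n" "u z = u (int i)" "v z = v (int i)" by (rule nat_residue)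
    ultimately have "e = {U i, V i}" by (simp only: spoke_def u_nat v_nat)
    with \<open>i < n\<close> show "e \<in> {{U i, V i} | i. i < n}" by blast
  qed
  moreover have "{{V i, V ((i + k) mod n)} | i. i < n} = range inner"
  proof (intro subset_antisym subsetI)
    fix e assume "e \<in> {{V i, V ((i + k) mod n)} | i. i < n}"
    then obtain i where "i < n" "e = {V i, V ((i + k) mod n)}" by blast
    then have "e = inner (int i)" by (simp only: inner_def v_nat mod_nat of_nat_add)
    then show "e \<in> range inner" by blast
  next
    fix e assume "e \<in> range inner"
    then obtain z where "e = inner z" by blast
    moreover obtain i where "i < n" "v z = v (int i)" by (rule nat_residue)
    ultimately have "e = {V i, V ((i + k) mod n)}"
      using cong_add(2)[of z "int i" "int k"]
      by (simp only: inner_def v_nat mod_nat of_nat_add)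
    with \<open>i < n\<close> show "e \<in> {{V i, V ((i + k) mod n)} | i. i < n}" by blast
  qed
  ultimately show ?thesis by (simp only: petersen_def graph.select_convs)
qed

lemma vertex_cases:
  assumes "{a, b} \<in> edges (petersen n k)"
  obtains x where "a = u x" | x where "a = v x"
  using assms unfolding edges_petersen outer_def spoke_def inner_def
  by (auto simp: doubleton_eq_iff)

lemma adjacent_u:
  assumes "{u x, b} \<in> edges (petersen n k)"
  shows "b = u (x + 1) \<or> b = u (x - 1) \<or> b = v x"
proof -
  consider z where "{u x, b} = outer z" | z where "{u x, b} = spoke z"
    | z where "{u x, b} = inner z"
    using assms unfolding edges_petersen by blast
  then show ?thesis
  proof cases
    case 1
    then have "u x = u z \<and> b = u (z + 1) \<or> u x = u (z + 1) \<and> b = u z"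
      by (auto simp: outer_def doubleton_eq_iff)
    then show ?thesis using cong_add(1)[of x z 1] cong_add(1)[of x "z + 1" "-1"] by auto
  next
    case 2
    then show ?thesis by (auto simp: spoke_def doubleton_eq_iff u_neq_v u_cong_v)
  next
    case 3
    then show ?thesis by (auto simp: inner_def doubleton_eq_iff u_neq_v)
  qed
qed

lemma adjacent_v:
  assumes "{v x, b} \<in> edges (petersen n k)"
  shows "b = v (x + int k) \<or> b = v (x - int k) \<or> b = u x"
proof -
  consider z where "{v x, b} = outer z" | z where "{v x, b} = spoke z"
    | z where "{v x, b} = inner z"
    using assms unfolding edges_petersen by blast
  then show ?thesis
  proof cases
    case 1
    then show ?thesis by (auto simp: outer_def doubleton_eq_iff u_neq_v)
  next
    case 2
    then show ?thesis by (auto simp: spoke_def doubleton_eq_iff u_neq_v simp flip: u_cong_v)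
  next
    case 3
    then have "v x = v z \<and> b = v (z + int k) \<or> v x = v (z + int k) \<and> b = v z"
      by (auto simp: inner_def doubleton_eq_iff)
    then show ?thesis
      using cong_add(2)[of x z "int k"] cong_add(2)[of x "z + int k" "- int k"] by auto
  qed
qed

text \<open>An edge could equal another one with its end points exchanged; this would force \<open>n\<close> to divide 2
  for outer edges, and \<open>2k\<close> for inner edges.\<close>

lemma outer_eq_iff: "outer x = outer y \<longleftrightarrow> int n dvd x - y"
proof
  assume eq: "outer x = outer y"
  show "int n dvd x - y"
  proof (rule ccontr)
    assume "\<not> int n dvd x - y"
    with eq have "int n dvd x - (y + 1)" "int n dvd (x + 1) - y"
      by (auto simp: outer_def doubleton_eq_iff u_eq_iff)
    from dvd_diff[OF this(2) this(1)] have "int n dvd 2" by simp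
    from dvd_abs_less_imp_0[OF this] show False using k_ge_4 k_less by simp
  qed
next
  assume "int n dvd x - y"
  then have "u x = u y" by (simp add: u_eq_iff)
  then show "outer x = outer y" using cong_add(1)[of x y 1] by (simp add: outer_def)
qed

lemma spoke_eq_iff: "spoke x = spoke y \<longleftrightarrow> int n dvd x - y"
  by (auto simp: spoke_def doubleton_eq_iff u_neq_v u_eq_iff v_eq_iff)

lemma inner_eq_iff: "inner x = inner y \<longleftrightarrow> int n dvd x - y"
proof
  assume eq: "inner x = inner y"
  show "int n dvd x - y"
  proof (rule ccontr)
    assume "\<not> int n dvd x - y"
    with eq have "int n dvd x - (y + int k)" "int n dvd (x + int k) - y"
      by (auto simp: inner_def doubleton_eq_iff v_eq_iff)
    from dvd_diff[OF this(2) this(1)] have "int n dvd 2 * int k" by simp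
    from dvd_abs_less_imp_0[OF this] show False using k_ge_4 k_less by simp
  qed
next
  assume "int n dvd x - y"
  then have "v x = v y" by (simp add: v_eq_iff)
  then show "inner x = inner y" using cong_add(2)[of x y "int k"] by (simp add: inner_def)
qed

lemma edge_types_distinct:
  "outer x \<noteq> spoke y" "spoke y \<noteq> outer x" "outer x \<noteq> inner y" "inner y \<noteq> outer x"
  "spoke x \<noteq> inner y" "inner y \<noteq> spoke x"
  by (auto simp: outer_def spoke_def inner_def doubleton_eq_iff u_neq_v)

lemma range_eq_image:
  assumes "\<And>x y. g x = g y \<longleftrightarrow> int n dvd x - y"
  shows "range g = g ` {0..<int n}" "inj_on g {0..<int n}"
proof -
  have "g z = g (z mod int n)" for z by (simp add: assms minus_mod_eq_mult_div)
  moreover have "z mod int n \<in> {0..<int n}" for z using n_pos by simp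
  ultimately show "range g = g ` {0..<int n}" by blast
  show "inj_on g {0..<int n}"
  proof (rule inj_onI)
    fix x y assume "x \<in> {0..<int n}" "y \<in> {0..<int n}" "g x = g y"
    then show "x = y" using dvd_abs_less_imp_0[of "int n" "x - y"] by (auto simp: assms)
  qed
qed

lemma finite_card_edges:
  "finite (edges (petersen n k))" "card (edges (petersen n k)) = 3 * n"
proof -
  have fin: "finite (range outer)" "finite (range spoke)" "finite (range inner)"
    by (simp_all only: range_eq_image(1)[OF outer_eq_iff] range_eq_image(1)[OF spoke_eq_iff]
        range_eq_image(1)[OF inner_eq_iff] finite_imageI finite_atLeastLessThan_int)
  then show "finite (edges (petersen n k))" by (simp add: edges_petersen)
  have "card (range outer) = n" "card (range spoke) = n" "card (range inner) = n"
    by (simp_all add: range_eq_image(1)[OF outer_eq_iff] range_eq_image(1)[OF spoke_eq_iff]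
        range_eq_image(1)[OF inner_eq_iff] card_image range_eq_image(2)[OF outer_eq_iff]
        range_eq_image(2)[OF spoke_eq_iff] range_eq_image(2)[OF inner_eq_iff])
  moreover have "range outer \<inter> range spoke = {}" "(range outer \<union> range spoke) \<inter> range inner = {}"
    using edge_types_distinct by blast+
  ultimately show "card (edges (petersen n k)) = 3 * n"
    unfolding edges_petersen using fin by (simp add: card_Un_disjoint)
qed

lemma simple_petersen: "simple_graph (petersen n k)"
proof -
  have u: "u x \<in> verts (petersen n k)" and v: "v x \<in> verts (petersen n k)" for x
    using n_pos by (auto simp: petersen_def u_def v_def nat_less_iff)
  have "u x \<noteq> u (x + 1)" "v x \<noteq> v (x + int k)" for x
    using dvd_abs_less_imp_0[of "int n" "-1"] dvd_abs_less_imp_0[of "int n" "- int k"]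
      k_ge_4 k_less by (auto simp: u_eq_iff v_eq_iff)
  then show ?thesis
    unfolding simple_graph_def edges_petersen
    by (auto simp: outer_def spoke_def inner_def u v u_neq_v card_insert_if)
qed

section \<open>Classification of the 6-cycles\<close>

text \<open>The two numbers in the name count the outer and the inner edges; the remaining edges are spokes.
  Each definition describes a cycle only for the appropriate \<open>k\<close>: the edge from \<open>u (z + 3k)\<close> to \<open>u z\<close>
  in the first one needs \<open>3k = n \<plusminus> 1\<close>, the inner path of the second one needs \<open>2k = n - 2\<close>, and the
  third one closes up for \<open>n = 6k\<close>.\<close>

definition hex_1_3 :: "int \<Rightarrow> petersen_vertex set set" where
  "hex_1_3 z = hexagon (v z) (v (z + int k)) (v (z + 2 * int k)) (v (z + 3 * int k)) (u (z + 3 * int k)) (u z)"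

definition hex_2_2 :: "int \<Rightarrow> petersen_vertex set set" where
  "hex_2_2 z = hexagon (u z) (u (z + 1)) (u (z + 2)) (v (z + 2)) (v (z - int k)) (v z)"

definition hex_0_6 :: "int \<Rightarrow> petersen_vertex set set" where
  "hex_0_6 z = hexagon (v z) (v (z + int k)) (v (z + 2 * int k)) (v (z + 3 * int k))
     (v (z + 4 * int k)) (v (z + 5 * int k))"

lemma v_shift: "v (x + int n) = v x"
  by (simp add: v_eq_iff)

lemma not_dvd: "t \<noteq> 0 \<Longrightarrow> \<bar>t\<bar> < int n \<Longrightarrow> \<not> int n dvd t"
  using dvd_abs_less_imp_0 by blast

lemma adjacent_u_u: "{u x, u y} \<in> edges (petersen n k) \<Longrightarrow> u y = u (x + 1) \<or> u y = u (x - 1)"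
  using adjacent_u[of x "u y"] u_neq_v by auto

lemma adjacent_u_v: "{u x, v y} \<in> edges (petersen n k) \<Longrightarrow> v y = v x"
  using adjacent_u[of x "v y"] u_neq_v by auto

lemma adjacent_v_v:
  "{v x, v y} \<in> edges (petersen n k) \<Longrightarrow> v y = v (x + int k) \<or> v y = v (x - int k)"
  using adjacent_v[of x "v y"] u_neq_v by auto

text \<open>Next to the spoke, the walk must continue along the outer rim on one side and along the inner rim
  on the other, in directions \<open>s\<close> and \<open>t\<close>. It cannot turn back, so each of the two vertices \<open>c\<close> and \<open>d\<close>
  either continues on its rim or is reached by a spoke. The closing edge \<open>cd\<close> turns each of the four
  combinations into a congruence modulo \<open>n\<close>; the sizes of \<open>k\<close> and \<open>n\<close> rule out two of them.\<close>

lemma hexagon_through_spoke: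
  assumes dist: "distinct [u x, b, c, d, e, v x]"
    and edges: "hexagon (u x) b c d e (v x) \<subseteq> edges (petersen n k)"
  shows "(3 * k = n + 1 \<or> 3 * k + 1 = n) \<and> (\<exists>z. hexagon (u x) b c d e (v x) = hex_1_3 z)
    \<or> n = 2 * k + 2 \<and> (\<exists>z. hexagon (u x) b c d e (v x) = hex_2_2 z)"
proof -
  have kn: "4 \<le> int k" "2 * int k < int n" using k_ge_4 k_less by auto
  have E: "{u x, b} \<in> edges (petersen n k)" "{b, c} \<in> edges (petersen n k)"
    "{c, d} \<in> edges (petersen n k)" "{e, d} \<in> edges (petersen n k)" "{v x, e} \<in> edges (petersen n k)"
    using edges by (simp_all add: hexagon_def insert_commute)
  have "b = u (x + 1) \<or> b = u (x - 1)" using adjacent_u[OF E(1)] dist by auto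
  then obtain s where s: "s = 1 \<or> s = -1" and b: "b = u (x + s)" by force
  have "e = v (x + int k) \<or> e = v (x - int k)" using adjacent_v[OF E(5)] dist by auto
  then obtain t where t: "t = 1 \<or> t = -1" and e: "e = v (x + t * int k)" by force
  have c: "c = u (x + 2 * s) \<or> c = v (x + s)"
    using adjacent_u[OF E(2)[unfolded b]] s dist by (auto simp: add.commute)
  have d: "d = v (x + 2 * t * int k) \<or> d = u (x + t * int k)"
    using adjacent_v[OF E(4)[unfolded e]] t dist by (auto simp: add.commute)
  consider (uu) "c = u (x + 2 * s)" "d = u (x + t * int k)"
    | (uv) "c = u (x + 2 * s)" "d = v (x + 2 * t * int k)"
    | (vu) "c = v (x + s)" "d = u (x + t * int k)"
    | (vv) "c = v (x + s)" "d = v (x + 2 * t * int k)"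
    using c d by blast
  then show ?thesis
  proof cases
    case uu
    from adjacent_u_u[OF E(3)[unfolded uu]]
    have "int n dvd t * int k - 2 * s - 1 \<or> int n dvd t * int k - 2 * s + 1"
      by (auto simp: u_eq_iff algebra_simps)
    then show ?thesis using s t kn not_dvd by auto
  next
    case uv
    from adjacent_u_v[OF E(3)[unfolded uv]]
    have dvd: "int n dvd 2 * t * int k - 2 * s" by (auto simp: v_eq_iff algebra_simps)
    have st: "t = - s"
    proof (rule ccontr)
      assume "t \<noteq> - s"
      then show False using s t dvd kn not_dvd by auto
    qed
    have "2 * int k + 2 = - s * (2 * t * int k - 2 * s)" using s st by (auto simp: algebra_simps)
    then have "int n dvd 2 * int k + 2" using dvd by simp
    then have n: "int n = 2 * int k + 2" using dvd_abs_less_double[of "int n" "2 * int k + 2"] kn by auto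
    show ?thesis
    proof (rule disjI2, rule conjI)
      show "n = 2 * k + 2" using n by linarith
      show "\<exists>z. hexagon (u x) b c d e (v x) = hex_2_2 z"
        using s
      proof
        assume "s = 1"
        have "v (x - 2 * int k) = v (x + 2)"
          using v_shift[of "x - 2 * int k"] by (simp add: n)
        then have "hexagon (u x) b c d e (v x) = hex_2_2 x"
          using \<open>s = 1\<close> st b e uv by (simp add: hex_2_2_def)
        then show ?thesis by blast
      next
        assume "s = -1"
        have "v (x + 2 * int k) = v (x - 2)" "v (x + int k) = v (x - 2 - int k)"
          using v_shift[of "x - 2"] v_shift[of "x - 2 - int k"]
          by (simp_all add: n algebra_simps)
        then have "hexagon (u x) b c d e (v x)
            = hexagon (u x) (u (x - 1)) (u (x - 2)) (v (x - 2)) (v (x - 2 - int k)) (v x)"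
          using \<open>s = -1\<close> st b e uv by simp
        also have "\<dots> = hex_2_2 (x - 2)"
          unfolding hex_2_2_def by (subst hexagon_flip_3) simp
        finally have "hexagon (u x) b c d e (v x) = hex_2_2 (x - 2)" .
        then show ?thesis by blast
      qed
    qed
  next
    case vu
    from adjacent_u_v[of "x + t * int k" "x + s"] E(3)[unfolded vu]
    have "int n dvd s - t * int k" by (auto simp: v_eq_iff insert_commute)
    then show ?thesis using s t kn not_dvd by auto
  next
    case vv
    from adjacent_v_v[OF E(3)[unfolded vv]]
    have "int n dvd 2 * t * int k - s - int k \<or> int n dvd 2 * t * int k - s + int k"
      by (auto simp: v_eq_iff algebra_simps)
    then have dvd: "int n dvd 3 * t * int k - s" using s t kn not_dvd by auto
    have "3 * int k - s * t = t * (3 * t * int k - s)" using t by (auto simp: algebra_simps)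
    then have "int n dvd 3 * int k - s * t" using dvd by simp
    then have "3 * int k - s * t = int n"
      using dvd_abs_less_double[of "int n" "3 * int k - s * t"] s t kn by auto
    then have n: "3 * k = n + 1 \<or> 3 * k + 1 = n" using s t by auto
    have end_eq: "u (x + s) = u (x + 3 * t * int k)" "v (x + s) = v (x + 3 * t * int k)"
      using dvd by (simp_all add: u_eq_iff v_eq_iff dvd_diff_commute)
    have "\<exists>z. hexagon (u x) b c d e (v x) = hex_1_3 z"
      using t
    proof
      assume "t = 1"
      then have "hexagon (u x) b c d e (v x) = hex_1_3 x"
        unfolding hex_1_3_def b e vv end_eq by (subst hexagon_flip) simp
      then show ?thesis by blast
    next
      assume "t = -1"
      then have "hexagon (u x) b c d e (v x) = hex_1_3 (x - 3 * int k)"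
        unfolding hex_1_3_def b e vv end_eq by (subst hexagon_rotate_2) (simp add: algebra_simps)
      then show ?thesis by blast
    qed
    with n show ?thesis by blast
  qed
qed

text \<open>A walk on the outer rim that never turns back keeps its direction, and six steps do not close up
  because \<open>n \<ge> 9\<close>.\<close>

lemma no_outer_hexagon:
  assumes dist: "distinct [u x, b, c, d, e, f]"
    and U: "{b, c, d, e, f} \<subseteq> range u"
    and edges: "hexagon (u x) b c d e f \<subseteq> edges (petersen n k)"
  shows False
proof -
  have E: "{u x, b} \<in> edges (petersen n k)" "{b, c} \<in> edges (petersen n k)"
    "{c, d} \<in> edges (petersen n k)" "{d, e} \<in> edges (petersen n k)" "{e, f} \<in> edges (petersen n k)"
    "{f, u x} \<in> edges (petersen n k)"
    using edges by (simp_all add: hexagon_def)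
  have V: "b \<noteq> v y" "c \<noteq> v y" "d \<noteq> v y" "e \<noteq> v y" "f \<noteq> v y" for y
    using U u_neq_v by auto
  have "b = u (x + 1) \<or> b = u (x - 1)" using adjacent_u[OF E(1)] V by auto
  then obtain t where t: "t = 1 \<or> t = -1" and b: "b = u (x + t)" by force
  have c: "c = u (x + 2 * t)"
    using adjacent_u[OF E(2)[unfolded b]] V t dist by (auto simp: add.commute)
  have d: "d = u (x + 3 * t)"
    using adjacent_u[OF E(3)[unfolded c]] V t dist b by (auto simp: algebra_simps)
  have e: "e = u (x + 4 * t)"
    using adjacent_u[OF E(4)[unfolded d]] V t dist c by (auto simp: algebra_simps)
  have f: "f = u (x + 5 * t)"
    using adjacent_u[OF E(5)[unfolded e]] V t dist d by (auto simp: algebra_simps)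
  have "u x = u (x + 6 * t)"
    using adjacent_u[OF E(6)[unfolded f]] t dist e u_neq_v by (auto simp: algebra_simps)
  then have "int n dvd 6" using t by (auto simp: u_eq_iff)
  then show False using not_dvd[of 6] k_ge_4 k_less by simp
qed

text \<open>As on the outer rim, the walk keeps its direction, so \<open>n\<close> divides \<open>6k\<close>. As \<open>6k < 3n\<close>, this leaves
  \<open>6k = n\<close> and \<open>6k = 2n\<close>, and in the latter case the walk is back at its start after three steps.\<close>

lemma hexagon_inner:
  assumes dist: "distinct [v x, b, c, d, e, f]"
    and V: "\<And>w. w \<in> {b, c, d, e, f} \<Longrightarrow> w \<notin> range u"
    and edges: "hexagon (v x) b c d e f \<subseteq> edges (petersen n k)"
  shows "n = 6 * k \<and> (\<exists>z. hexagon (v x) b c d e f = hex_0_6 z)"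
proof -
  have kn: "4 \<le> int k" "2 * int k < int n" using k_ge_4 k_less by auto
  have E: "{v x, b} \<in> edges (petersen n k)" "{b, c} \<in> edges (petersen n k)"
    "{c, d} \<in> edges (petersen n k)" "{d, e} \<in> edges (petersen n k)" "{e, f} \<in> edges (petersen n k)"
    "{f, v x} \<in> edges (petersen n k)"
    using edges by (simp_all add: hexagon_def)
  have "b = v (x + int k) \<or> b = v (x - int k)" using adjacent_v[OF E(1)] V[of b] by auto
  then obtain t where t: "t = 1 \<or> t = -1" and b: "b = v (x + t * int k)" by force
  have c: "c = v (x + 2 * t * int k)"
    using adjacent_v[OF E(2)[unfolded b]] V[of c] t dist by (auto simp: add.commute)
  have d: "d = v (x + 3 * t * int k)"
    using adjacent_v[OF E(3)[unfolded c]] V[of d] t dist b by (auto simp: algebra_simps)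
  have e: "e = v (x + 4 * t * int k)"
    using adjacent_v[OF E(4)[unfolded d]] V[of e] t dist c by (auto simp: algebra_simps)
  have f: "f = v (x + 5 * t * int k)"
    using adjacent_v[OF E(5)[unfolded e]] V[of f] t dist d by (auto simp: algebra_simps)
  have "v x = v (x + 6 * t * int k)"
    using adjacent_v[OF E(6)[unfolded f]] t dist e u_neq_v by (auto simp: algebra_simps)
  then have "int n dvd 6 * int k" using t by (auto simp: v_eq_iff)
  then obtain q where q: "6 * int k = int n * q" by (elim dvdE)
  have not3: "\<not> int n dvd 3 * int k"
  proof
    assume "int n dvd 3 * int k"
    then have "d = v x" using t by (auto simp: d v_eq_iff)
    then show False using dist by auto
  qed
  have "0 < q" using q kn by (smt (verit) zero_less_mult_pos)
  have "int n * q < int n * 3" using q kn by linarith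
  then have "q < 3" using n_pos by simp
  moreover have "q \<noteq> 2" using not3 q by auto
  ultimately have "q = 1" using \<open>0 < q\<close> by linarith
  then have n: "int n = 6 * int k" using q by simp
  have "\<exists>z. hexagon (v x) b c d e f = hex_0_6 z"
    using t
  proof
    assume "t = 1"
    then show ?thesis unfolding b c d e f hex_0_6_def by auto
  next
    assume "t = -1"
    then have "hexagon (v x) b c d e f = hex_0_6 (x - 5 * int k)"
      unfolding b c d e f hex_0_6_def by (subst hexagon_flip) (simp add: algebra_simps)
    then show ?thesis by blast
  qed
  moreover have "n = 6 * k" using n by linarith
  ultimately show ?thesis by blast
qed

text \<open>If both rims are visited, some cyclically consecutive pair of vertices goes from the inner rim to the
  outer one. After a rotation this pair is the last and the first vertex, and they form a spoke.\<close>

lemma hexagon_cases: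
  assumes dist: "distinct [a, b, c, d, e, f]"
    and edges: "hexagon a b c d e f \<subseteq> edges (petersen n k)"
  shows "(3 * k = n + 1 \<or> 3 * k + 1 = n) \<and> (\<exists>z. hexagon a b c d e f = hex_1_3 z)
    \<or> n = 2 * k + 2 \<and> (\<exists>z. hexagon a b c d e f = hex_2_2 z)
    \<or> n = 6 * k \<and> (\<exists>z. hexagon a b c d e f = hex_0_6 z)"
proof -
  let ?E = "edges (petersen n k)"
  have vertex: "w \<in> range u \<or> w \<in> range v" if "{w, w'} \<in> ?E" for w w'
    using vertex_cases[OF that] by blast
  have mixed: ?thesis
    if d': "distinct [a', b', c', d', e', f']" and eq: "hexagon a' b' c' d' e' f' = hexagon a b c d e f"
      and "a' \<in> range u" "f' \<notin> range u" for a' b' c' d' e' f'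
  proof -
    obtain x where x: "a' = u x" using \<open>a' \<in> range u\<close> by blast
    have "{f', u x} \<in> ?E"
      using edges unfolding eq[symmetric] x by (simp add: hexagon_def)
    then have "{u x, f'} \<in> ?E" by (simp add: insert_commute)
    moreover from \<open>{f', u x} \<in> ?E\<close> vertex \<open>f' \<notin> range u\<close> obtain y where "f' = v y" by blast
    ultimately have f: "f' = v x" using adjacent_u_v by blast
    from hexagon_through_spoke[of x b' c' d' e'] d' edges show ?thesis
      unfolding eq[symmetric] x f by blast
  qed
  have E: "{a, b} \<in> ?E" "{b, c} \<in> ?E" "{c, d} \<in> ?E" "{d, e} \<in> ?E" "{e, f} \<in> ?E" "{f, a} \<in> ?E"
    using edges by (simp_all add: hexagon_def)
  have rot: "hexagon b c d e f a = hexagon a b c d e f" "hexagon c d e f a b = hexagon a b c d e f"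
    "hexagon d e f a b c = hexagon a b c d e f" "hexagon e f a b c d = hexagon a b c d e f"
    "hexagon f a b c d e = hexagon a b c d e f"
    by (metis hexagon_rotate)+
  have dist_rot: "distinct [b, c, d, e, f, a]" "distinct [c, d, e, f, a, b]"
    "distinct [d, e, f, a, b, c]" "distinct [e, f, a, b, c, d]" "distinct [f, a, b, c, d, e]"
    using dist by auto
  consider (outer) "{a, b, c, d, e, f} \<subseteq> range u" | (inner) "{a, b, c, d, e, f} \<inter> range u = {}"
    | "a \<in> range u" "f \<notin> range u" | "b \<in> range u" "a \<notin> range u" | "c \<in> range u" "b \<notin> range u"
    | "d \<in> range u" "c \<notin> range u" | "e \<in> range u" "d \<notin> range u" | "f \<in> range u" "e \<notin> range u"
    by (cases "a \<in> range u"; cases "b \<in> range u"; cases "c \<in> range u"; cases "d \<in> range u";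
        cases "e \<in> range u"; cases "f \<in> range u"; simp)
  then show ?thesis
  proof cases
    case outer
    then obtain x where "a = u x" by blast
    then show ?thesis using no_outer_hexagon[of x b c d e f] dist edges outer by auto
  next
    case inner
    then obtain x where "a = v x" using vertex[OF E(1)] by auto
    then show ?thesis using hexagon_inner[of x b c d e f] dist edges inner by auto
  qed (use mixed[OF dist refl] mixed[OF dist_rot(1) rot(1)] mixed[OF dist_rot(2) rot(2)]
      mixed[OF dist_rot(3) rot(3)] mixed[OF dist_rot(4) rot(4)] mixed[OF dist_rot(5) rot(5)] in blast)+
qed

section \<open>Anti-Ramsey numbers of the 6-cycle\<close>

lemma edge_in_petersen:
  "outer x \<in> edges (petersen n k)" "spoke x \<in> edges (petersen n k)" "inner x \<in> edges (petersen n k)"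
  by (auto simp: edges_petersen)

lemma edge_cases:
  assumes "e \<in> edges (petersen n k)"
  obtains y where "e = outer y" | y where "e = spoke y" | y where "e = inner y"
  using assms unfolding edges_petersen by blast

definition is_hexagon :: "petersen_vertex set set \<Rightarrow> bool" where
  "is_hexagon F \<longleftrightarrow> (\<exists>a b c d e f. distinct [a, b, c, d, e, f] \<and> F = hexagon a b c d e f)"

lemma is_hexagonI: "distinct [a, b, c, d, e, f] \<Longrightarrow> is_hexagon (hexagon a b c d e f)"
  unfolding is_hexagon_def by blast

lemma copies_eqI:
  assumes hexagons: "\<And>z. z \<in> I \<Longrightarrow> is_hexagon (C z)"
    and sub: "\<And>z. z \<in> I \<Longrightarrow> C z \<subseteq> edges (petersen n k)"
    and all: "\<And>a b c d e f. distinct [a, b, c, d, e, f] \<Longrightarrow>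
      hexagon a b c d e f \<subseteq> edges (petersen n k) \<Longrightarrow> hexagon a b c d e f \<in> C ` I"
  shows "edges ` {K. copy_of (cycle_graph 6) (petersen n k) K} = C ` I"
proof (intro subset_antisym subsetI)
  fix F assume "F \<in> edges ` {K. copy_of (cycle_graph 6) (petersen n k) K}"
  then obtain K where K: "copy_of (cycle_graph 6) (petersen n k) K" "F = edges K" by blast
  from K(1) obtain a b c d e f where "distinct [a, b, c, d, e, f]" "edges K = hexagon a b c d e f"
    "edges K \<subseteq> edges (petersen n k)" by (rule copy_of_cycle_6_hexagon)
  with all K(2) show "F \<in> C ` I" by simp
next
  fix F assume "F \<in> C ` I"
  then obtain z where "z \<in> I" "F = C z" by blast
  moreover from hexagons[OF \<open>z \<in> I\<close>] obtain a b c d e f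
    where "distinct [a, b, c, d, e, f]" "C z = hexagon a b c d e f"
    unfolding is_hexagon_def by blast
  ultimately obtain K where "copy_of (cycle_graph 6) (petersen n k) K" "edges K = F"
    using hexagon_copy_of_cycle_6[OF simple_petersen] sub by metis
  then show "F \<in> edges ` {K. copy_of (cycle_graph 6) (petersen n k) K}" by blast
qed

lemma residue_eq: "z \<in> {0..<int n} \<Longrightarrow> int n dvd x - z \<Longrightarrow> z = x mod int n"
  by (simp flip: mod_eq_dvd_iff)

lemma u_mod: "u (z mod int n + c) = u (z + c)" "u (z mod int n) = u z"
  and v_mod: "v (z mod int n + c) = v (z + c)" "v (z mod int n - c) = v (z - c)"
    "v (z mod int n) = v z"
  by (simp_all add: u_def v_def mod_simps)

lemma size_bounds: "4 \<le> int k" "2 * int k < int n"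
  using k_ge_4 k_less by auto

lemma hex_0_6_edges:
  assumes "n = 6 * k"
  shows "hex_0_6 z = {inner z, inner (z + int k), inner (z + 2 * int k), inner (z + 3 * int k),
    inner (z + 4 * int k), inner (z + 5 * int k)}"
proof -
  have int_n: "int n = 6 * int k" using assms by linarith
  have "inner (z + 5 * int k) = {v (z + 5 * int k), v z}"
    using v_shift[of z] by (simp add: inner_def int_n algebra_simps)
  then show ?thesis by (simp add: hex_0_6_def hexagon_def inner_def algebra_simps)
qed

lemma hex_2_2_edges:
  assumes "n = 2 * k + 2"
  shows "hex_2_2 z = {outer z, outer (z + 1), spoke (z + 2), inner (z + 2), inner (z - int k), spoke z}"
proof -
  have int_n: "int n = 2 * int k + 2" using assms by linarith
  have "inner (z + 2) = {v (z + 2), v (z - int k)}"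
    using v_shift[of "z - int k"] by (simp add: inner_def int_n algebra_simps)
  moreover have "inner (z - int k) = {v (z - int k), v z}" by (simp add: inner_def)
  ultimately show ?thesis
    by (simp add: hex_2_2_def hexagon_def outer_def spoke_def insert_commute[of "v z" "u z"] algebra_simps)
qed

text \<open>The offset \<open>\<delta>\<close> is 0 if \<open>3k = n + 1\<close> and -1 if \<open>3k = n - 1\<close>, depending on the direction in which three
  inner steps move. The counting of 6-cycles through given edges is the same for
  every offset, so both cases can be treated together.\<close>

lemma hex_1_3_edges:
  assumes "3 * k = n + 1 \<or> 3 * k + 1 = n"
  obtains \<delta> where "\<And>z. hex_1_3 z = {inner z, inner (z + int k), inner (z + 2 * int k),
    spoke (z + 3 * int k), outer (z + \<delta>), spoke z}"
proof -
  have *: "hex_1_3 z = {inner z, inner (z + int k), inner (z + 2 * int k),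
      spoke (z + 3 * int k), outer (z + \<delta>), spoke z}"
    if "outer (z + \<delta>) = {u (z + 3 * int k), u z}" for z \<delta>
    unfolding hex_1_3_def hexagon_def that inner_def spoke_def
    by (simp add: insert_commute[of "v (z + 3 * int k)" "u (z + 3 * int k)"] add.assoc)
  show thesis
    using assms
  proof
    assume "3 * k = n + 1"
    then have n: "3 * int k = int n + 1" by linarith
    have end_eq: "u (z + 3 * int k) = u (z + 1)" for z by (simp add: n u_eq_iff)
    show thesis by (rule that[of 0], rule *) (simp add: outer_def end_eq insert_commute)
  next
    assume "3 * k + 1 = n"
    then have n: "3 * int k = int n - 1" by linarith
    have end_eq: "u (z + 3 * int k) = u (z + -1)" for z by (simp add: n u_eq_iff)
    show thesis by (rule that[of "-1"], rule *) (simp add: outer_def end_eq)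
  qed
qed

lemma distinct_inner: "inner x \<noteq> inner (x + int k)" "inner (x + int k) \<noteq> inner (x + 2 * int k)"
  using not_dvd[of "int k"] size_bounds by (auto simp: inner_eq_iff)

text \<open>The 6-cycles are edge-disjoint: the indices of the edges of \<open>hex_0_6 z\<close> are the residues congruent to
  \<open>z\<close> modulo \<open>k\<close>. Hence each of the \<open>k\<close> cycles needs a repetition of its own, and one suffices.\<close>

lemma anti_ramsey_0_6:
  assumes n: "n = 6 * k"
  shows "anti_ramsey (petersen n k) (cycle_graph 6) = 3 * n - k"
proof -
  let ?E = "edges (petersen n k)"
  let ?I = "{0..<int k}"
  define M where "M = (\<lambda>z. (inner z, inner (z + int k))) ` ?I"
  have int_n: "int n = 6 * int k" using n by linarith
  note edges = hex_0_6_edges[OF n]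
  have sub: "hex_0_6 z \<subseteq> ?E" for z by (simp add: edges edge_in_petersen)
  have dvd: "int k dvd y - z" if "inner y \<in> hex_0_6 z" for y z
  proof -
    obtain j where "int n dvd y - (z + j * int k)"
    proof -
      from \<open>inner y \<in> hex_0_6 z\<close> consider "int n dvd y - (z + 0 * int k)" | "int n dvd y - (z + 1 * int k)"
        | "int n dvd y - (z + 2 * int k)" | "int n dvd y - (z + 3 * int k)"
        | "int n dvd y - (z + 4 * int k)" | "int n dvd y - (z + 5 * int k)"
        by (auto simp: edges inner_eq_iff)
      then show thesis by cases (fact that)+
    qed
    moreover have "int k dvd int n" by (simp add: int_n)
    ultimately have "int k dvd y - (z + j * int k)" by (rule dvd_trans[rotated])
    then have "int k dvd (y - (z + j * int k)) + j * int k" by (intro dvd_add) auto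
    then show ?thesis by simp
  qed
  have unique: "card {z \<in> ?I. e \<in> hex_0_6 z} \<le> 1" for e
  proof -
    have eq: "x = y" if xy: "x \<in> ?I" "y \<in> ?I" "e \<in> hex_0_6 x" "e \<in> hex_0_6 y" for x y
    proof -
      obtain w where e: "e = inner w" using xy(3) by (auto simp: edges)
      have "int k dvd w - y" "int k dvd w - x" using dvd xy e by blast+
      from dvd_diff[OF this] have "int k dvd x - y" by simp
      then show "x = y" using dvd_abs_less_imp_0[of "int k" "x - y"] xy by auto
    qed
    have "finite {z \<in> ?I. e \<in> hex_0_6 z}" by (rule finite_subset[of _ ?I]) auto
    then have "card {z \<in> ?I. e \<in> hex_0_6 z} \<le> Suc 0"
      using eq by (simp only: card_le_Suc0_iff_eq) blast
    then show ?thesis by simp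
  qed
  show ?thesis
    unfolding finite_card_edges(2)[symmetric]
  proof (rule anti_ramsey_eq_card_minus_loss)
    show "finite ?E" by (rule finite_card_edges)
    show "finite M" by (simp add: M_def)
    show "card M \<le> k" using card_image_le[of ?I] by (simp add: M_def)
    show "edges ` {K. copy_of (cycle_graph 6) (petersen n k) K} = hex_0_6 ` ?I"
    proof (rule copies_eqI)
      fix z
      show "is_hexagon (hex_0_6 z)"
        unfolding hex_0_6_def
        by (rule is_hexagonI) (use k_ge_4 in \<open>simp add: v_eq_iff not_dvd int_n\<close>)
    next
      fix a b c d e f
      assume "distinct [a, b, c, d, e, f]" "hexagon a b c d e f \<subseteq> ?E"
      from hexagon_cases[OF this] n k_ge_4 obtain z where z: "hexagon a b c d e f = hex_0_6 z" by auto
      have shift: "hex_0_6 (y + int k) = hex_0_6 y" for y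
      proof -
        have "inner (y + 6 * int k) = inner y" by (simp add: inner_eq_iff int_n)
        then show ?thesis unfolding edges by (simp add: algebra_simps insert_commute)
      qed
      have step: "hex_0_6 (y + int j * int k) = hex_0_6 y" for y j
      proof (induction j)
        case (Suc j)
        have "y + int (Suc j) * int k = (y + int j * int k) + int k" by (simp add: algebra_simps)
        then show ?case by (simp only: shift Suc)
      qed simp
      have "hex_0_6 z = hex_0_6 (z mod int k)"
      proof (cases "0 \<le> z div int k")
        case True
        then show ?thesis using step[of "z mod int k" "nat (z div int k)"] by simp
      next
        case False
        then show ?thesis using step[of z "nat (- (z div int k))"]
          by (simp add: minus_div_mult_eq_mod)
      qed
      then show "hexagon a b c d e f \<in> hex_0_6 ` ?I" using z k_ge_4 by simp
    qed (use sub in auto)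
  next
    fix c :: "petersen_vertex set \<Rightarrow> nat" and z
    assume "z \<in> ?I" "\<forall>(e, f)\<in>M. c e = c f"
    then have "c (inner z) = c (inner (z + int k))" by (auto simp: M_def)
    then show "\<not> inj_on c (hex_0_6 z)"
      using distinct_inner(1)[of z] by (auto simp: inj_on_def edges)
  next
    fix c :: "petersen_vertex set \<Rightarrow> nat"
    assume c: "\<And>z. z \<in> ?I \<Longrightarrow> \<not> inj_on c (hex_0_6 z)"
    have "1 * card ?I \<le> 1 * (card ?E - card (c ` ?E))"
    proof (rule repeated_color_loss[where C = hex_0_6 and r = 1 and s = 1])
      fix e f
      have "card {z \<in> ?I. e \<in> hex_0_6 z \<and> f \<in> hex_0_6 z} \<le> card {z \<in> ?I. e \<in> hex_0_6 z}"
        by (rule card_mono[OF finite_subset[of _ ?I]]) auto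
      then show "card {z \<in> ?I. e \<in> hex_0_6 z \<and> f \<in> hex_0_6 z} \<le> 1"
        using unique[of e] by linarith
    qed (use c sub unique finite_card_edges in auto)
    then show "k \<le> card ?E - card (c ` ?E)" by simp
  qed
qed

text \<open>As \<open>k\<close> is invertible modulo \<open>n\<close>, the inner rim is a single \<open>n\<close>-cycle, and each 6-cycle contains a
  path of three consecutive edges of it. Inner edges lie on three 6-cycles, spokes on two, outer edges
  on one; two edges lie on at most two common 6-cycles. Two edges that are
  neighbours on the inner rim attain this maximum, so every second such pair is merged.\<close>

lemma anti_ramsey_1_3:
  assumes n: "3 * k = n + 1 \<or> 3 * k + 1 = n"
  shows "anti_ramsey (petersen n k) (cycle_graph 6) = 3 * n - (n + 1) div 2"
proof -
  let ?E = "edges (petersen n k)"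
  let ?I = "{0..<int n}"
  define M where "M = (\<lambda>t. (inner (2 * int t * int k), inner (2 * int t * int k + int k))) ` {..<(n + 1) div 2}"
  obtain \<delta> where edges: "\<And>z. hex_1_3 z = {inner z, inner (z + int k), inner (z + 2 * int k),
    spoke (z + 3 * int k), outer (z + \<delta>), spoke z}" using hex_1_3_edges[OF n] by blast
  have periodic: "hex_1_3 (z mod int n) = hex_1_3 z" for z
    by (simp add: hex_1_3_def u_mod v_mod)
  have sub: "hex_1_3 z \<subseteq> ?E" for z by (simp add: edges edge_in_petersen)
  have inner_in: "{z \<in> ?I. inner y \<in> hex_1_3 z}
      \<subseteq> {y mod int n, (y - int k) mod int n, (y - 2 * int k) mod int n}" for y
    using residue_eq[of _ y] residue_eq[of _ "y - int k"] residue_eq[of _ "y - 2 * int k"]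
    by (auto simp: edges inner_eq_iff edge_types_distinct algebra_simps)
  have spoke_in: "{z \<in> ?I. spoke y \<in> hex_1_3 z} \<subseteq> {y mod int n, (y - 3 * int k) mod int n}" for y
    using residue_eq[of _ y] residue_eq[of _ "y - 3 * int k"]
    by (auto simp: edges spoke_eq_iff edge_types_distinct algebra_simps)
  have outer_in: "{z \<in> ?I. outer y \<in> hex_1_3 z} \<subseteq> {(y - \<delta>) mod int n}" for y
    using residue_eq[of _ "y - \<delta>"]
    by (auto simp: edges outer_eq_iff edge_types_distinct algebra_simps)
  have card3: "card {p, q, r} \<le> 3" and card2: "card {p, q} \<le> 2" for p q r :: int
    by (simp_all add: card_insert_if)
  have edge2: "card {z \<in> ?I. e \<in> hex_1_3 z} \<le> 2" if "e \<in> ?E" "\<And>y. e \<noteq> inner y" for e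
    using that(1)
  proof (cases rule: edge_cases)
    case (1 y)
    then show ?thesis using card_mono[OF _ outer_in[of y]] by simp
  next
    case (2 y)
    then show ?thesis using card_mono[OF _ spoke_in[of y]] card2 by (auto intro: order_trans)
  qed (use that(2) in blast)
  have edge3: "card {z \<in> ?I. e \<in> hex_1_3 z} \<le> 3" if "e \<in> ?E" for e
  proof (cases "\<exists>y. e = inner y")
    case True
    then obtain y where "e = inner y" by blast
    then show ?thesis using card_mono[OF _ inner_in[of y]] card3 by (auto intro: order_trans)
  next
    case False
    then show ?thesis using edge2[OF that] by fastforce
  qed
  \<comment> \<open>Two inner edges at distance at most two on the rim share a 6-cycle; sharing three would need a
    rim of length at most four.\<close>
  have no_third: "\<not> {y mod int n, (y - 2 * int k) mod int n} \<subseteq> {z. inner w \<in> hex_1_3 z}"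
    if "inner y \<noteq> inner w" for y w
  proof
    assume "{y mod int n, (y - 2 * int k) mod int n} \<subseteq> {z. inner w \<in> hex_1_3 z}"
    then have "inner w \<in> hex_1_3 y" "inner w \<in> hex_1_3 (y - 2 * int k)" by (simp_all add: periodic)
    then have "int n dvd w - y - int k \<or> int n dvd w - y - 2 * int k"
        "int n dvd w - y + int k \<or> int n dvd w - y + 2 * int k"
      using that by (auto simp: edges inner_eq_iff edge_types_distinct algebra_simps dvd_diff_commute)
    then have "int n dvd 2 * int k \<or> int n dvd 3 * int k \<or> int n dvd 4 * int k"
      using dvd_diff[of "int n" "w - y + int k" "w - y - int k"]
        dvd_diff[of "int n" "w - y + int k" "w - y - 2 * int k"]
        dvd_diff[of "int n" "w - y + 2 * int k" "w - y - int k"]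
        dvd_diff[of "int n" "w - y + 2 * int k" "w - y - 2 * int k"]
      by (auto simp: algebra_simps)
    then show False
      using dvd_abs_less_double[of "int n" "2 * int k"] dvd_abs_less_double[of "int n" "3 * int k"]
        dvd_abs_less_double[of "int n" "4 * int k"] n size_bounds by auto
  qed
  have fin: "finite {z \<in> ?I. P z}" for P
    by (rule finite_subset[of _ ?I]) auto
  have pair: "card {z \<in> ?I. e \<in> hex_1_3 z \<and> f \<in> hex_1_3 z} \<le> 2"
    if "e \<in> ?E" "f \<in> ?E" "e \<noteq> f" for e f
  proof -
    let ?Z = "{z \<in> ?I. e \<in> hex_1_3 z \<and> f \<in> hex_1_3 z}"
    consider "\<And>y. e \<noteq> inner y" | "\<And>y. f \<noteq> inner y" | y w where "e = inner y" "f = inner w" by blast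
    then show ?thesis
    proof cases
      case 1
      have "card ?Z \<le> card {z \<in> ?I. e \<in> hex_1_3 z}" by (rule card_mono[OF fin]) auto
      then show ?thesis using edge2[OF that(1) 1] by linarith
    next
      case 2
      have "card ?Z \<le> card {z \<in> ?I. f \<in> hex_1_3 z}" by (rule card_mono[OF fin]) auto
      then show ?thesis using edge2[OF that(2) 2] by linarith
    next
      case 3
      let ?T = "{y mod int n, (y - int k) mod int n, (y - 2 * int k) mod int n}"
      have "?Z \<subseteq> ?T" using inner_in[of y] 3 by blast
      moreover have "?Z \<noteq> ?T" using no_third[of y w] that(3) 3 by blast
      ultimately have "card ?Z < card ?T" by (intro psubset_card_mono) auto
      then show ?thesis using card3[of "y mod int n" "(y - int k) mod int n" "(y - 2 * int k) mod int n"]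
        by linarith
    qed
  qed
  show ?thesis
    unfolding finite_card_edges(2)[symmetric]
  proof (rule anti_ramsey_eq_card_minus_loss)
    show "finite ?E" by (rule finite_card_edges)
    show "finite M" by (simp add: M_def)
    show "card M \<le> (n + 1) div 2" using card_image_le[of "{..<(n + 1) div 2}"] by (simp add: M_def)
    show "edges ` {K. copy_of (cycle_graph 6) (petersen n k) K} = hex_1_3 ` ?I"
    proof (rule copies_eqI)
      fix z
      have "\<not> int n dvd 3 * int k"
        using dvd_abs_less_double[of "int n" "3 * int k"] n size_bounds by auto
      moreover have "\<not> n dvd k" using k_ge_4 k_less by (auto dest: dvd_imp_le)
      ultimately show "is_hexagon (hex_1_3 z)"
        unfolding hex_1_3_def using size_bounds
        by (intro is_hexagonI) (simp add: v_eq_iff u_eq_iff u_neq_v not_dvd)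
    next
      fix a b c d e f
      assume "distinct [a, b, c, d, e, f]" "hexagon a b c d e f \<subseteq> ?E"
      from hexagon_cases[OF this] n k_ge_4 obtain z where z: "hexagon a b c d e f = hex_1_3 z" by auto
      then have "hexagon a b c d e f = hex_1_3 (z mod int n)" by (simp add: periodic)
      then show "hexagon a b c d e f \<in> hex_1_3 ` ?I" using n_pos by simp
    qed (use sub in auto)
  next
    fix c :: "petersen_vertex set \<Rightarrow> nat" and z
    assume c: "\<forall>(e, f)\<in>M. c e = c f"
    have merged: "c (inner (2 * int t * int k)) = c (inner (2 * int t * int k + int k))"
      if "t < (n + 1) div 2" for t using c that by (auto simp: M_def)
    \<comment> \<open>As \<open>3k\<close> is congruent to \<open>s\<close>, the inverse of \<open>k\<close> is \<open>3s\<close>, and \<open>j = 3sz\<close> is the position of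
      \<open>inner z\<close> along the inner rim, counted in steps of \<open>k\<close>.\<close>
    obtain s where s: "s = 1 \<or> s = -1" "3 * int k = s + int n"
    proof (cases "3 * k = n + 1")
      case True
      then show thesis by (intro that[of 1]) auto
    next
      case False
      then show thesis using n by (intro that[of "-1"]) auto
    qed
    define j where "j = nat ((3 * s * z) mod int n)"
    have "j < n" using n_pos by (simp add: j_def nat_less_iff)
    have "int n dvd int j * int k - z"
    proof -
      have "int n dvd int j - 3 * s * z" using n_pos by (simp add: j_def mod_eq_dvd_iff[symmetric])
      then have "int n dvd (int j - 3 * s * z) * int k + s * z * int n" by simp
      also have "(int j - 3 * s * z) * int k + s * z * int n = int j * int k - s * z * (3 * int k - int n)"
        by (simp add: algebra_simps)
      also have "\<dots> = int j * int k - z" using s by auto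
      finally show ?thesis .
    qed
    then have jk: "inner z = inner (int j * int k)" "inner (z + int k) = inner (int j * int k + int k)"
      "inner (z + 2 * int k) = inner (int j * int k + 2 * int k)"
      by (simp_all add: inner_eq_iff dvd_diff_commute algebra_simps)
    have "c (inner z) = c (inner (z + int k)) \<or> c (inner (z + int k)) = c (inner (z + 2 * int k))"
    proof (cases "even j")
      case True
      then obtain t where "j = 2 * t" by (elim evenE)
      then show ?thesis using merged[of t] jk \<open>j < n\<close> by simp
    next
      case False
      then obtain t where j: "j = 2 * t + 1" by (elim oddE)
      show ?thesis
      proof (cases "j + 1 < n")
        case True
        then show ?thesis using merged[of "t + 1"] jk j by (simp add: algebra_simps)
      next
        case False
        \<comment> \<open>The path starts at the last edge of the rim and wraps around to the first two, which are
          merged.\<close>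
        then have "int j + 1 = int n" using \<open>j < n\<close> by linarith
        then have "int j * int k + int k = int n * int k" by (metis distrib_right mult_1)
        then have "inner (z + int k) = inner 0" "inner (z + 2 * int k) = inner (int k)"
          unfolding jk inner_eq_iff by (simp_all add: algebra_simps)
        then show ?thesis using merged[of 0] n_pos by simp
      qed
    qed
    then show "\<not> inj_on c (hex_1_3 z)"
      using distinct_inner[of z] by (auto simp: inj_on_def edges)
  next
    fix c :: "petersen_vertex set \<Rightarrow> nat"
    assume c: "\<And>z. z \<in> ?I \<Longrightarrow> \<not> inj_on c (hex_1_3 z)"
    have "1 * card ?I \<le> 2 * (card ?E - card (c ` ?E))"
      by (rule repeated_color_loss[where C = hex_1_3 and r = 3 and s = 2]) (use c sub edge3 pair finite_card_edges in auto)
    then show "(n + 1) div 2 \<le> card ?E - card (c ` ?E)" by simp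
  qed
qed

text \<open>Every edge lies on exactly two 6-cycles, and these determine the edge: their indices differ by 1, 2
  or \<open>k\<close> up to sign for outer edges, spokes and inner edges. So a class of two edges covers at most one
  6-cycle and a class of three edges at most three. The class consisting of \<open>outer (z + 1)\<close>,
  \<open>outer (z + 2)\<close> and \<open>spoke (z + 2)\<close> does cover the cycles with indices \<open>z\<close>, \<open>z + 1\<close> and \<open>z + 2\<close>. Such
  triples handle the first \<open>3 (n div 3)\<close> cycles, single pairs the at most two others.\<close>

lemma anti_ramsey_2_2:
  assumes n: "n = 2 * k + 2"
  shows "anti_ramsey (petersen n k) (cycle_graph 6) = 3 * n - (2 * (n div 3) + n mod 3)"
proof -
  let ?E = "edges (petersen n k)"
  let ?I = "{0..<int n}"
  have int_n: "int n = 2 * int k + 2" using n by linarith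
  define q where "q = n div 3"
  define M where "M = (\<lambda>t. (outer (3 * int t + 1), spoke (3 * int t + 2))) ` {..<q}
    \<union> (\<lambda>t. (outer (3 * int t + 2), spoke (3 * int t + 2))) ` {..<q}
    \<union> (\<lambda>i. (outer (int i), outer (int i + 1))) ` {3 * q..<n}"
  note edges = hex_2_2_edges[OF n]
  have periodic: "hex_2_2 (z mod int n) = hex_2_2 z" for z
    by (simp add: hex_2_2_def u_mod v_mod)
  have sub: "hex_2_2 z \<subseteq> ?E" for z by (simp add: edges edge_in_petersen)
  have fin: "finite {z \<in> ?I. P z}" for P
    by (rule finite_subset[of _ ?I]) auto
  have edge: "card {z \<in> ?I. e \<in> hex_2_2 z} \<le> 2" if "e \<in> ?E" for e
  proof -
    have "\<exists>p q. {z \<in> ?I. e \<in> hex_2_2 z} \<subseteq> {p, q}"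
      using that
    proof (cases rule: edge_cases)
      case (1 y)
      have "{z \<in> ?I. e \<in> hex_2_2 z} \<subseteq> {y mod int n, (y - 1) mod int n}"
        using residue_eq[of _ y] residue_eq[of _ "y - 1"]
        by (auto simp: 1 edges outer_eq_iff edge_types_distinct algebra_simps)
      then show ?thesis by blast
    next
      case (2 y)
      have "{z \<in> ?I. e \<in> hex_2_2 z} \<subseteq> {y mod int n, (y - 2) mod int n}"
        using residue_eq[of _ y] residue_eq[of _ "y - 2"]
        by (auto simp: 2 edges spoke_eq_iff edge_types_distinct algebra_simps)
      then show ?thesis by blast
    next
      case (3 y)
      have "{z \<in> ?I. e \<in> hex_2_2 z} \<subseteq> {(y + int k) mod int n, (y - 2) mod int n}"
        using residue_eq[of _ "y + int k"] residue_eq[of _ "y - 2"]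
        by (auto simp: 3 edges inner_eq_iff edge_types_distinct algebra_simps)
      then show ?thesis by blast
    qed
    then obtain p q where "{z \<in> ?I. e \<in> hex_2_2 z} \<subseteq> {p, q}" by blast
    then have "card {z \<in> ?I. e \<in> hex_2_2 z} \<le> card {p, q}" by (intro card_mono) auto
    also have "\<dots> \<le> 2" by (simp add: card_insert_if)
    finally show ?thesis .
  qed
  \<comment> \<open>The only edge on the cycles with indices \<open>z\<close> and \<open>z'\<close> when \<open>z - z'\<close> is congruent to \<open>c\<close>; in the
    inner case \<open>z + 2\<close> and \<open>z' - k\<close> agree, or \<open>z - k\<close> and \<open>z' + 2\<close>.\<close>
  define shared where "shared z z' c =
    (if c = 1 then outer z else if c = -1 then outer z'
     else if c = 2 then spoke z else if c = -2 then spoke z'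
     else if c = int k then inner (z + 2) else inner (z' + 2))" for z z' c
  have shared: "\<exists>c\<in>{1, -1, 2, -2, int k, - int k}. int n dvd z - z' - c \<and> e = shared z z' c"
    if in_both: "e \<in> hex_2_2 z" "e \<in> hex_2_2 z'" and apart: "\<not> int n dvd z - z'" for e z z'
  proof -
    have "e \<in> ?E" using sub in_both by blast
    then show ?thesis
    proof (cases rule: edge_cases)
      case (1 y)
      then have "int n dvd y - z \<or> int n dvd y - (z + 1)" "int n dvd y - z' \<or> int n dvd y - (z' + 1)"
        using in_both by (simp_all add: edges outer_eq_iff edge_types_distinct)
      then consider "int n dvd y - z" "int n dvd y - (z' + 1)" | "int n dvd y - (z + 1)" "int n dvd y - z'"
        using apart dvd_diff[of "int n" "y - z'" "y - z"] dvd_diff[of "int n" "y - (z' + 1)" "y - (z + 1)"]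
        by auto
      then show ?thesis
      proof cases
        case a: 1
        from dvd_diff[OF a(2,1)] have "int n dvd z - z' - 1" by (simp add: algebra_simps)
        moreover have "e = outer z" using a 1 by (simp add: outer_eq_iff)
        ultimately show ?thesis by (auto simp: shared_def)
      next
        case a: 2
        from dvd_diff[OF a(2,1)] have "int n dvd z - z' - - 1" by (simp add: algebra_simps)
        moreover have "e = outer z'" using a 1 by (simp add: outer_eq_iff)
        ultimately show ?thesis by (auto simp: shared_def)
      qed
    next
      case (2 y)
      then have "int n dvd y - z \<or> int n dvd y - (z + 2)" "int n dvd y - z' \<or> int n dvd y - (z' + 2)"
        using in_both by (auto simp add: edges spoke_eq_iff edge_types_distinct)
      then consider "int n dvd y - z" "int n dvd y - (z' + 2)" | "int n dvd y - (z + 2)" "int n dvd y - z'"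
        using apart dvd_diff[of "int n" "y - z'" "y - z"] dvd_diff[of "int n" "y - (z' + 2)" "y - (z + 2)"]
        by auto
      then show ?thesis
      proof cases
        case a: 1
        from dvd_diff[OF a(2,1)] have "int n dvd z - z' - 2" by (simp add: algebra_simps)
        moreover have "e = spoke z" using a 2 by (simp add: spoke_eq_iff)
        ultimately show ?thesis by (auto simp: shared_def)
      next
        case a: 2
        from dvd_diff[OF a(2,1)] have "int n dvd z - z' - - 2" by (simp add: algebra_simps)
        moreover have "e = spoke z'" using a 2 by (simp add: spoke_eq_iff)
        ultimately show ?thesis by (auto simp: shared_def)
      qed
    next
      case (3 y)
      then have "int n dvd y - (z + 2) \<or> int n dvd y - (z - int k)"
          "int n dvd y - (z' + 2) \<or> int n dvd y - (z' - int k)"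
        using in_both by (simp_all add: edges inner_eq_iff edge_types_distinct)
      then consider "int n dvd y - (z + 2)" "int n dvd y - (z' - int k)"
        | "int n dvd y - (z - int k)" "int n dvd y - (z' + 2)"
        using apart dvd_diff[of "int n" "y - (z' + 2)" "y - (z + 2)"]
          dvd_diff[of "int n" "y - (z' - int k)" "y - (z - int k)"]
        by auto
      then show ?thesis
      proof cases
        case a: 1
        have "int n dvd (y - (z' - int k)) - (y - (z + 2)) - int n"
          using dvd_diff[OF dvd_diff[OF a(2,1)] dvd_refl] .
        then have "int n dvd z - z' - int k" by (simp add: int_n algebra_simps)
        moreover have "e = inner (z + 2)" using a 3 by (simp add: inner_eq_iff)
        ultimately show ?thesis using k_ge_4 by (intro bexI[of _ "int k"]) (auto simp: shared_def)
      next
        case a: 2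
        have "int n dvd (y - (z' + 2)) - (y - (z - int k)) + int n"
          using dvd_add[OF dvd_diff[OF a(2,1)] dvd_refl] .
        then have "int n dvd z - z' - - int k" by (simp add: int_n algebra_simps)
        moreover have "e = inner (z' + 2)" using a 3 by (simp add: inner_eq_iff)
        ultimately show ?thesis using k_ge_4 by (intro bexI[of _ "- int k"]) (auto simp: shared_def)
      qed
    qed
  qed
  have pair: "card {z \<in> ?I. e \<in> hex_2_2 z \<and> f \<in> hex_2_2 z} \<le> 1" if "e \<noteq> f" for e f
  proof -
    have eq: "x = y" if xy: "x \<in> ?I" "y \<in> ?I" "e \<in> hex_2_2 x" "f \<in> hex_2_2 x"
      "e \<in> hex_2_2 y" "f \<in> hex_2_2 y" for x y
    proof (rule ccontr)
      assume "x \<noteq> y"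
      moreover have "\<bar>x - y\<bar> < int n" using xy(1,2) by auto
      ultimately have "\<not> int n dvd x - y" using not_dvd[of "x - y"] by simp
      then obtain c d where c: "c \<in> {1, -1, 2, -2, int k, - int k}" "int n dvd x - y - c" "e = shared x y c"
        and d: "d \<in> {1, -1, 2, -2, int k, - int k}" "int n dvd x - y - d" "f = shared x y d"
        using shared xy by meson
      from dvd_diff[OF d(2) c(2)] have "int n dvd c - d" by simp
      \<comment> \<open>The six possible offsets are pairwise incongruent modulo \<open>n = 2k + 2\<close>.\<close>
      moreover have "\<bar>c\<bar> \<le> int k" "\<bar>d\<bar> \<le> int k" using c(1) d(1) k_ge_4 by auto
      then have "\<bar>c - d\<bar> < int n" using int_n by linarith
      ultimately have "c = d" using dvd_abs_less_imp_0 by fastforce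
      with c d \<open>e \<noteq> f\<close> show False by simp
    qed
    have "card {z \<in> ?I. e \<in> hex_2_2 z \<and> f \<in> hex_2_2 z} \<le> Suc 0"
      using fin[of "\<lambda>z. e \<in> hex_2_2 z \<and> f \<in> hex_2_2 z"] eq
      by (simp only: card_le_Suc0_iff_eq) blast
    then show ?thesis by simp
  qed
  show ?thesis
    unfolding finite_card_edges(2)[symmetric]
  proof (rule anti_ramsey_eq_card_minus_loss)
    show "finite ?E" by (rule finite_card_edges)
    show "finite M" by (simp add: M_def)
    have "card M \<le> card {..<q} + card {..<q} + card {3 * q..<n}"
      unfolding M_def by (intro order_trans[OF card_Un_le] add_mono card_image_le) auto
    then show "card M \<le> 2 * (n div 3) + n mod 3"
      by (simp add: q_def minus_mult_div_eq_mod)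
    show "edges ` {K. copy_of (cycle_graph 6) (petersen n k) K} = hex_2_2 ` ?I"
    proof (rule copies_eqI)
      fix z
      have "\<not> n dvd k" using k_ge_4 k_less by (auto dest: dvd_imp_le)
      then show "is_hexagon (hex_2_2 z)"
        unfolding hex_2_2_def using size_bounds
        by (intro is_hexagonI) (simp add: v_eq_iff u_eq_iff u_neq_v not_dvd)
    next
      fix a b c d e f
      assume "distinct [a, b, c, d, e, f]" "hexagon a b c d e f \<subseteq> ?E"
      from hexagon_cases[OF this] n k_ge_4 obtain z where z: "hexagon a b c d e f = hex_2_2 z" by auto
      then have "hexagon a b c d e f = hex_2_2 (z mod int n)" by (simp add: periodic)
      then show "hexagon a b c d e f \<in> hex_2_2 ` ?I" using n_pos by simp
    qed (use sub in auto)
  next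
    fix c :: "petersen_vertex set \<Rightarrow> nat" and z
    assume z: "z \<in> ?I" and c: "\<forall>(e, f)\<in>M. c e = c f"
    define i where "i = nat z"
    have i: "z = int i" "i < n" using z by (auto simp: i_def)
    have triangle: "c (outer (3 * int t + 1)) = c (spoke (3 * int t + 2))"
      "c (outer (3 * int t + 2)) = c (spoke (3 * int t + 2))" if "t < q" for t
      using c that by (auto simp: M_def)
    have rest: "c (outer z) = c (outer (z + 1))" if "3 * q \<le> i"
      using c that i by (auto simp: M_def)
    have ne: "outer z \<noteq> outer (z + 1)" using not_dvd[of "-1"] k_ge_4 k_less by (auto simp: outer_eq_iff)
    have "c (outer z) = c (outer (z + 1)) \<or> c (outer (z + 1)) = c (spoke (z + 2)) \<or> c (outer z) = c (spoke z)"
    proof (cases "3 * q \<le> i")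
      case True
      then show ?thesis using rest by simp
    next
      case False
      define t where "t = i div 3"
      have "t < q" using False by (auto simp: t_def)
      have "i = 3 * t \<or> i = 3 * t + 1 \<or> i = 3 * t + 2" unfolding t_def by linarith
      then show ?thesis using triangle[OF \<open>t < q\<close>] i by (auto simp: algebra_simps)
    qed
    then show "\<not> inj_on c (hex_2_2 z)"
      using ne edge_types_distinct(1) by (auto simp: inj_on_def edges)
  next
    fix c :: "petersen_vertex set \<Rightarrow> nat"
    assume c: "\<And>z. z \<in> ?I \<Longrightarrow> \<not> inj_on c (hex_2_2 z)"
    have "2 * card ?I \<le> 3 * (card ?E - card (c ` ?E))"
      by (rule repeated_color_loss[where C = hex_2_2 and r = 2 and s = 1])
        (use c sub edge pair finite_card_edges in auto)
    then have "2 * n \<le> 3 * (card ?E - card (c ` ?E))" by simp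
    moreover have "n = 3 * (n div 3) + n mod 3" "n mod 3 < 3" by simp_all
    ultimately show "2 * (n div 3) + n mod 3 \<le> card ?E - card (c ` ?E)" by linarith
  qed
qed

lemma anti_ramsey_no_hexagon:
  assumes "3 * k \<noteq> n + 1" "3 * k + 1 \<noteq> n" "n \<noteq> 2 * k + 2" "n \<noteq> 6 * k"
  shows "anti_ramsey (petersen n k) (cycle_graph 6) = 3 * n"
proof -
  have "\<not> (\<exists>K. copy_of (cycle_graph 6) (petersen n k) K)"
  proof
    assume "\<exists>K. copy_of (cycle_graph 6) (petersen n k) K"
    then obtain K where "copy_of (cycle_graph 6) (petersen n k) K" ..
    then obtain a b c d e f where "distinct [a, b, c, d, e, f]" "edges K = hexagon a b c d e f"
      "edges K \<subseteq> edges (petersen n k)" by (rule copy_of_cycle_6_hexagon)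
    then show False using hexagon_cases[of a b c d e f] assms by auto
  qed
  then show ?thesis using anti_ramsey_no_copy finite_card_edges by metis
qed

end

theorem theorem1p6:
  fixes n k :: nat
  assumes "4 \<le> k" and "k \<le> (n - 1) div 2"
  shows "real (anti_ramsey (petersen n k) (cycle_graph 6)) =
    (if real k \<in> {(real n - 1) / 3, (real n + 1) / 3} then of_int \<lfloor>5 * real n / 2\<rfloor>
     else if real k = (real n - 2) / 2 then of_int \<lfloor>7 * real n / 3\<rfloor>
     else if real k = real n / 6 then 17 * real n / 6
     else 3 * real n)"
proof -
  have "2 * k < n" using assms by linarith
  interpret petersen_params n k by unfold_locales fact+
  have c13: "real k \<in> {(real n - 1) / 3, (real n + 1) / 3} \<longleftrightarrow> 3 * k = n + 1 \<or> 3 * k + 1 = n"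
    by (auto simp: field_simps)
  have c22: "real k = (real n - 2) / 2 \<longleftrightarrow> n = 2 * k + 2" by (auto simp: field_simps)
  have c06: "real k = real n / 6 \<longleftrightarrow> n = 6 * k" by (auto simp: field_simps)
  have floor: "\<lfloor>5 * real n / 2\<rfloor> = int (5 * n div 2)" "\<lfloor>7 * real n / 3\<rfloor> = int (7 * n div 3)"
    using floor_divide_of_nat_eq[of "5 * n" 2] floor_divide_of_nat_eq[of "7 * n" 3] by simp_all
  show ?thesis
    unfolding c13 c22 c06 floor
  proof (split if_split, intro conjI impI)
    assume "3 * k = n + 1 \<or> 3 * k + 1 = n"
    moreover have "3 * n - (n + 1) div 2 = 5 * n div 2" by linarith
    ultimately show "real (anti_ramsey (petersen n k) (cycle_graph 6)) = of_int (int (5 * n div 2))"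
      by (simp only: anti_ramsey_1_3 of_int_of_nat_eq)
  next
    assume no13: "\<not> (3 * k = n + 1 \<or> 3 * k + 1 = n)"
    consider (a) "n = 2 * k + 2" | (b) "n \<noteq> 2 * k + 2" "n = 6 * k" | (c) "n \<noteq> 2 * k + 2" "n \<noteq> 6 * k" by blast
    then show "real (anti_ramsey (petersen n k) (cycle_graph 6)) =
      (if n = 2 * k + 2 then of_int (int (7 * n div 3))
       else if n = 6 * k then 17 * real n / 6 else 3 * real n)"
    proof cases
      case a
      have "3 * n - (2 * (n div 3) + n mod 3) = 7 * n div 3"
        using div_mult_mod_eq[of n 3] by linarith
      with anti_ramsey_2_2[OF a] a show ?thesis by simp
    next
      case b
      from anti_ramsey_0_6[OF b(2)] b show ?thesis by simp
    next
      case c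
      with anti_ramsey_no_hexagon no13 show ?thesis by auto
    qed
  qed
qed

end
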